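(* There is an isomorphism of vector spaces $$\mathrm{End}_{\mathfrak p}(\mathbb W_1^{\otimes m})\cong\mathrm{Hom}_{\mathfrak{gl}(n)^{\oplus\ell}}(V^{\otimes m},\mathbb W_1^{\otimes m})=\bigoplus_{\vec\lambda\in\mathcal P_{m,\ell}}\mathrm{Hom}_{\mathfrak{gl}(n)^{\oplus\ell}}(V_{\vec\lambda}\boxtimes L_{\vec\lambda},\mathbb W_1^{\otimes m}),$$ given by restricting a $\mathfrak p$-endomorphism to the degree-zero part $V^{\otimes m}$.
   Context: Fix integers $\ell>1$, $n\ge m\ge1$; $\lceil i/n\rceil$ is the block index of $1\le i\le n\ell$. $\mathfrak p\subset\mathfrak{gl}(n\ell)\otimes\mathbb C[z]$ is the Lie subalgebra spanned by the $E_{ij}\otimes z^k$ ($k\ge0$) with $\lceil i/n\rceil-\lceil j/n\rceil+k\equiv0\pmod\ell$; its degree-zero part is $\mathfrak{gl}(n)^{\oplus\ell}$ embedded block diagonally. $V=\mathbb C^{n\ell}$, $\mathbb W_1=V\otimes\mathbb C[z]$ with the natural action, $\mathfrak p$ acting diagonally on $\mathbb W_1^{\otimes m}$. $\mathcal P_{m,\ell}$ is the set of $\ell$-tuples of partitions (at most $n$ parts) of total size $m$; $V_{\vec\lambda}$ is the outer tensor product of the polynomial irreducible $\mathfrak{gl}(n)$-modules with highest weights $\lambda^{(1)},\dots,\lambda^{(\ell)}$; $L_{\vec\lambda}$ is the irreducible $W=\mathfrak S_m\ltimes(\mathbb Z/\ell\mathbb Z)^m$-module induced from $\boxtimes_j(L_{\lambda^{(j)}}\otimes(\chi^{j-1})^{\boxtimes|\lambda^{(j)}|})$,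 where $\chi(a)=e^{2\pi\sqrt{-1}a/\ell}$ and $L_\mu$ is the irreducible symmetric group module with $L_{(1^r)}$ trivial and $L_{(r)}$ sign. The decomposition on the right uses the known $(\mathfrak{gl}(n)^{\oplus\ell},W)$-bimodule isomorphism $V^{\otimes m}\cong\bigoplus_{\vec\lambda}V_{\vec\lambda}\boxtimes L_{\vec\lambda}$, where $W$ acts on $V^{\otimes m}$ by permuting factors and by $(\mathbb Z/\ell\mathbb Z)$ acting on the $j$-th factor via $a.e_i=\chi(a)^{\lceil i/n\rceil-1}e_i$. *)

theory Defs
  imports Complex_Main "HOL-Library.FuncSet"
begin

text \<open>Basis of V = C^(n l): e_1 .. e_(n l).  Basis of
  W_1^(tensor m) = (V tensor C[z])^(tensor m): pairs (xs, ks) of lists of length m,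
  xs!p in {1..n l} the V-index and ks!p the z-exponent of the p-th tensor factor.
  Vectors are finitely supported coefficient functions on this basis.\<close>

type_synonym idx = "nat list \<times> nat list"

definition blk :: "nat \<Rightarrow> nat \<Rightarrow> nat" where
  "blk n i = nat \<lceil>real i / real n\<rceil>"

definition basisW :: "nat \<Rightarrow> nat \<Rightarrow> nat \<Rightarrow> idx set" where
  "basisW n l m = {(xs, ks). length xs = m \<and> length ks = m \<and> (\<forall>i\<in>set xs. 1 \<le> i \<and> i \<le> n * l)}"

definition Wm :: "nat \<Rightarrow> nat \<Rightarrow> nat \<Rightarrow> (idx \<Rightarrow> complex) set" where
  "Wm n l m = {w. finite {b. w b \<noteq> 0} \<and> (\<forall>b. w b \<noteq> 0 \<longrightarrow> b \<in> basisW n l m)}"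

definition V0 :: "nat \<Rightarrow> nat \<Rightarrow> nat \<Rightarrow> (idx \<Rightarrow> complex) set" where
  "V0 n l m = {w \<in> Wm n l m. \<forall>xs ks. w (xs, ks) \<noteq> 0 \<longrightarrow> (\<forall>k\<in>set ks. k = 0)}"

text \<open>Diagonal action of E_ij tensor z^k on W_1^(tensor m):
  e_(xs) z^(ks) maps to sum over p with xs!p = j of e_(xs[p:=i]) z^(ks[p := ks!p + k]).\<close>
definition act :: "nat \<Rightarrow> nat \<Rightarrow> nat \<Rightarrow> nat \<Rightarrow> (idx \<Rightarrow> complex) \<Rightarrow> (idx \<Rightarrow> complex)" where
  "act m i j k w = (\<lambda>(xs, ks). \<Sum>p<m. if xs ! p = i \<and> k \<le> ks ! p
                                  then w (xs[p := j], ks[p := ks ! p - k]) else 0)"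

text \<open>Spanning elements E_ij tensor z^k of the Lie algebra p.\<close>
definition p_gen :: "nat \<Rightarrow> nat \<Rightarrow> nat \<Rightarrow> nat \<Rightarrow> nat \<Rightarrow> bool" where
  "p_gen n l i j k \<longleftrightarrow> 1 \<le> i \<and> i \<le> n * l \<and> 1 \<le> j \<and> j \<le> n * l \<and>
     (int (blk n i) - int (blk n j) + int k) mod int l = 0"

text \<open>Spanning elements E_ij of gl(n)^(direct sum l), block diagonal.\<close>
definition gl_gen :: "nat \<Rightarrow> nat \<Rightarrow> nat \<Rightarrow> nat \<Rightarrow> bool" where
  "gl_gen n l i j \<longleftrightarrow> 1 \<le> i \<and> i \<le> n * l \<and> 1 \<le> j \<and> j \<le> n * l \<and> blk n i = blk n j"

definition lin_on :: "(idx \<Rightarrow> complex) set \<Rightarrow> ((idx \<Rightarrow> complex) \<Rightarrow> (idx \<Rightarrow> complex)) \<Rightarrow> bool" where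
  "lin_on A T \<longleftrightarrow> (\<forall>x\<in>A. \<forall>y\<in>A. \<forall>a c::complex.
      T (\<lambda>t. a * x t + c * y t) = (\<lambda>t. a * T x t + c * T y t))"

definition EndP :: "nat \<Rightarrow> nat \<Rightarrow> nat \<Rightarrow> ((idx \<Rightarrow> complex) \<Rightarrow> (idx \<Rightarrow> complex)) set" where
  "EndP n l m = {T \<in> extensional (Wm n l m). (\<forall>w\<in>Wm n l m. T w \<in> Wm n l m) \<and> lin_on (Wm n l m) T \<and>
     (\<forall>i j k w. p_gen n l i j k \<and> w \<in> Wm n l m \<longrightarrow> T (act m i j k w) = act m i j k (T w))}"

definition HomG :: "nat \<Rightarrow> nat \<Rightarrow> nat \<Rightarrow> ((idx \<Rightarrow> complex) \<Rightarrow> (idx \<Rightarrow> complex)) set" where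
  "HomG n l m = {S \<in> extensional (V0 n l m). (\<forall>v\<in>V0 n l m. S v \<in> Wm n l m) \<and> lin_on (V0 n l m) S \<and>
     (\<forall>i j v. gl_gen n l i j \<and> v \<in> V0 n l m \<longrightarrow> S (act m i j 0 v) = act m i j 0 (S v))}"

end

theory Submission
  imports Defs "HOL-Combinatorics.Permutations"
begin

text \<open>
  Restriction to the degree-zero part is injective because every basis vector
  \<open>e\<^bsub>xs\<^esub> z\<^bsup>ks\<^esup>\<close> arises from a degree-zero one by applying generators \<open>E\<^bsub>ij\<^esub> \<otimes> z\<^sup>k\<close> of \<open>p\<close>,
  one tensor position at a time; as \<open>m \<le> n\<close>, the auxiliary index \<open>j\<close> can be chosen fresh, so
  that each generator acts as a single substitution.

  For surjectivity, give a tensor position \<open>e\<^sub>i z\<^sup>k\<close> the colour \<open>(block i + k - 1) mod l\<close>; the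
  generators of \<open>p\<close> preserve colours. For a basis vector \<open>b = (xs, ks)\<close> let \<open>V = canon b\<close> be the
  degree-zero index list with pairwise distinct entries and the same colours as \<open>b\<close>. A
  \<open>gl(n)\<^bsup>\<oplus>l\<^esup>\<close>-homomorphism \<open>S\<close> is extended by sending \<open>e\<^sub>b\<close> to \<open>S e\<^sub>V\<close> with every
  \<open>e\<^bsub>\<sigma>V\<^esub> z\<^sup>c\<close> relabelled to \<open>e\<^bsub>\<sigma>xs\<^esub> z\<^bsup>c+\<sigma>ks\<^esup>\<close>; a generator of \<open>p\<close> moves \<open>b\<close> without
  changing its colours and acts on the relabelled vectors in the same way, so the extension
  commutes with \<open>p\<close>. It agrees with \<open>S\<close> on \<open>e\<^sub>V\<close> because \<open>S e\<^sub>V\<close> has the weight of \<open>e\<^sub>V\<close>, hence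
  is supported on permutations of \<open>V\<close>; and every degree-zero basis vector lies in the
  \<open>gl\<close>-submodule generated by a distinct \<open>e\<^sub>V\<close> with the same block pattern, so the extension
  restricts to \<open>S\<close>.
\<close>

section \<open>Finitely supported vectors and linear maps\<close>

definition basis_vec :: "idx \<Rightarrow> idx \<Rightarrow> complex" where
  "basis_vec b = (\<lambda>t. if t = b then 1 else 0)"

definition vsupp :: "(idx \<Rightarrow> complex) \<Rightarrow> idx set" where
  "vsupp w = {b. w b \<noteq> 0}"

definition lincomb_closed :: "(idx \<Rightarrow> complex) set \<Rightarrow> bool" where
  "lincomb_closed A \<longleftrightarrow> (\<lambda>t. 0) \<in> A \<and> (\<forall>x\<in>A. \<forall>y\<in>A. \<forall>a c. (\<lambda>t. a * x t + c * y t) \<in> A)"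

lemma lincomb_closedD: "lincomb_closed A \<Longrightarrow> x \<in> A \<Longrightarrow> y \<in> A \<Longrightarrow> (\<lambda>t. a * x t + c * y t) \<in> A"
  unfolding lincomb_closed_def by blast

lemma lincomb_closed_sum:
  assumes "lincomb_closed A" "finite F" "\<And>b. b \<in> F \<Longrightarrow> f b \<in> A"
  shows "(\<lambda>t. \<Sum>b\<in>F. a b * f b t) \<in> A"
  using assms(2,3)
proof (induction F rule: finite_induct)
  case empty
  then show ?case using assms(1) by (simp add: lincomb_closed_def)
next
  case (insert x F)
  have "(\<lambda>t. a x * f x t + 1 * (\<Sum>b\<in>F. a b * f b t)) \<in> A"
    using insert by (intro lincomb_closedD[OF assms(1)]) auto
  then show ?case using insert by simp
qed

lemma lin_onD: "lin_on A T \<Longrightarrow> x \<in> A \<Longrightarrow> y \<in> A \<Longrightarrow> T (\<lambda>t. a * x t + c * y t) = (\<lambda>t. a * T x t + c * T y t)"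
  unfolding lin_on_def by blast

lemma lin_on_zero:
  assumes "lincomb_closed A" "lin_on A T"
  shows "T (\<lambda>t. 0) = (\<lambda>t. 0)"
proof -
  have "(\<lambda>t. 0) \<in> A" using assms(1) by (simp add: lincomb_closed_def)
  from lin_onD[OF assms(2) this this, of 0 0] show ?thesis by simp
qed

lemma lin_on_sum:
  assumes "lincomb_closed A" "lin_on A T" "finite F" "\<And>b. b \<in> F \<Longrightarrow> f b \<in> A"
  shows "T (\<lambda>t. \<Sum>b\<in>F. a b * f b t) = (\<lambda>t. \<Sum>b\<in>F. a b * T (f b) t)"
  using assms(3,4)
proof (induction F rule: finite_induct)
  case empty
  then show ?case using lin_on_zero[OF assms(1,2)] by simp
next
  case (insert x F)
  have "(\<lambda>t. \<Sum>b\<in>F. a b * f b t) \<in> A" using insert by (intro lincomb_closed_sum[OF assms(1)]) auto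
  then have "T (\<lambda>t. a x * f x t + 1 * (\<Sum>b\<in>F. a b * f b t)) =
        (\<lambda>t. a x * T (f x) t + 1 * T (\<lambda>t. \<Sum>b\<in>F. a b * f b t) t)"
    using insert by (intro lin_onD[OF assms(2)]) auto
  then show ?case using insert by simp
qed

lemma lin_on_scale: "lin_on A T \<Longrightarrow> x \<in> A \<Longrightarrow> T (\<lambda>t. a * x t) = (\<lambda>t. a * T x t)"
  using lin_onD[of A T x x a 0] by simp

lemma lin_on_restrict:
  assumes "lin_on A T" "B \<subseteq> A" "lincomb_closed B"
  shows "lin_on B (restrict T B)"
  using assms unfolding lin_on_def lincomb_closed_def by (auto simp: subset_iff)

lemma lin_on_comp:
  assumes "lin_on A F" "\<And>x. x \<in> A \<Longrightarrow> F x \<in> B" "lin_on B G"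
  shows "lin_on A (\<lambda>x. G (F x))"
  using assms unfolding lin_on_def by simp

lemma vec_expansion:
  assumes "finite (vsupp w)"
  shows "w = (\<lambda>t. \<Sum>b\<in>vsupp w. w b * basis_vec b t)"
proof
  fix t
  have "(\<Sum>b\<in>vsupp w. w b * basis_vec b t) = (if t \<in> vsupp w then w t else 0)"
    using assms by (simp add: basis_vec_def if_distrib cong: if_cong)
  then show "w t = (\<Sum>b\<in>vsupp w. w b * basis_vec b t)" by (simp add: vsupp_def)
qed

lemma lin_on_eq_on_basis_vecs:
  assumes A: "lincomb_closed A" "\<And>w. w \<in> A \<Longrightarrow> finite (vsupp w)"
      "\<And>w b. w \<in> A \<Longrightarrow> b \<in> vsupp w \<Longrightarrow> basis_vec b \<in> A"
    and lin: "lin_on A F" "lin_on A G"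
    and eq: "\<And>b. basis_vec b \<in> A \<Longrightarrow> F (basis_vec b) = G (basis_vec b)"
    and w: "w \<in> A"
  shows "F w = G w"
proof -
  note exp = vec_expansion[OF A(2)[OF w]]
  have "F w = (\<lambda>t. \<Sum>b\<in>vsupp w. w b * F (basis_vec b) t)"
    by (subst exp) (rule lin_on_sum[OF A(1) lin(1) A(2)[OF w] A(3)[OF w]])
  also have "\<dots> = (\<lambda>t. \<Sum>b\<in>vsupp w. w b * G (basis_vec b) t)"
    using eq A(3)[OF w] by simp
  also have "\<dots> = G w"
    by (subst (2) exp) (rule lin_on_sum[OF A(1) lin(2) A(2)[OF w] A(3)[OF w], symmetric])
  finally show ?thesis .
qed

lemma basisW_iff:
  "(ys, ls) \<in> basisW n l m \<longleftrightarrow> length ys = m \<and> length ls = m \<and> (\<forall>i\<in>set ys. 1 \<le> i \<and> i \<le> n * l)"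
  unfolding basisW_def by simp

lemma basisW_update:
  assumes "(ys, ls) \<in> basisW n l m" "1 \<le> i" "i \<le> n * l"
  shows "(ys[p := i], ls[p := c]) \<in> basisW n l m"
  using assms set_update_subset_insert[of ys p i] unfolding basisW_iff by auto

lemma Wm_iff: "w \<in> Wm n l m \<longleftrightarrow> finite (vsupp w) \<and> vsupp w \<subseteq> basisW n l m"
  unfolding Wm_def vsupp_def by blast

lemma lincomb_closed_Wm: "lincomb_closed (Wm n l m)"
  unfolding lincomb_closed_def
proof (intro conjI ballI allI)
  show "(\<lambda>t. 0) \<in> Wm n l m" by (simp add: Wm_iff vsupp_def)
  fix x y and a c :: complex
  assume "x \<in> Wm n l m" "y \<in> Wm n l m"
  moreover have "vsupp (\<lambda>t. a * x t + c * y t) \<subseteq> vsupp x \<union> vsupp y"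
    unfolding vsupp_def by auto
  ultimately show "(\<lambda>t. a * x t + c * y t) \<in> Wm n l m"
    unfolding Wm_iff by (meson finite_UnI finite_subset le_sup_iff subset_trans)
qed

lemma vsupp_basis_vec: "vsupp (basis_vec b) = {b}"
  unfolding vsupp_def basis_vec_def by simp

lemma basis_vec_Wm_iff: "basis_vec b \<in> Wm n l m \<longleftrightarrow> b \<in> basisW n l m"
  unfolding Wm_iff vsupp_basis_vec by simp

lemma basis_vec_Wm: "b \<in> basisW n l m \<Longrightarrow> basis_vec b \<in> Wm n l m"
  unfolding Wm_iff vsupp_def basis_vec_def by simp

lemma Wm_expansion: "w \<in> Wm n l m \<Longrightarrow> w = (\<lambda>t. \<Sum>b\<in>vsupp w. w b * basis_vec b t)"
  by (rule vec_expansion) (simp add: Wm_iff)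

lemma lincomb_closed_vsupp_sum:
  assumes "w \<in> Wm n l m" "lincomb_closed B" "\<And>b. b \<in> basisW n l m \<Longrightarrow> f b \<in> B"
  shows "(\<lambda>t. \<Sum>b\<in>vsupp w. w b * f b t) \<in> B"
  using assms by (intro lincomb_closed_sum) (auto simp: Wm_iff)

lemma lin_on_eq_on_Wm:
  assumes "lin_on (Wm n l m) F" "lin_on (Wm n l m) G"
    "\<And>b. b \<in> basisW n l m \<Longrightarrow> F (basis_vec b) = G (basis_vec b)" "w \<in> Wm n l m"
  shows "F w = G w"
proof (rule lin_on_eq_on_basis_vecs[OF lincomb_closed_Wm _ _ assms(1,2) _ assms(4)])
  show "finite (vsupp w)" if "w \<in> Wm n l m" for w
    using that by (simp add: Wm_iff)
  show "basis_vec b \<in> Wm n l m" if "w \<in> Wm n l m" "b \<in> vsupp w" for w b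
    using that by (auto simp: Wm_iff vsupp_basis_vec)
  show "F (basis_vec b) = G (basis_vec b)" if "basis_vec b \<in> Wm n l m" for b
    using that assms(3) by (simp add: basis_vec_Wm_iff)
qed

lemma V0_iff: "v \<in> V0 n l m \<longleftrightarrow> v \<in> Wm n l m \<and> (\<forall>b\<in>vsupp v. snd b = replicate m 0)"
proof (cases "v \<in> Wm n l m")
  case True
  then have "(ys, ls) \<in> basisW n l m" if "v (ys, ls) \<noteq> 0" for ys ls
    using that by (auto simp: Wm_iff vsupp_def)
  then have "(\<forall>k\<in>set ls. k = 0) \<longleftrightarrow> ls = replicate m 0" if "v (ys, ls) \<noteq> 0" for ys ls
    using that by (auto simp: basisW_iff intro: replicate_eqI)
  then show ?thesis using True by (auto simp: V0_def vsupp_def)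
qed (simp add: V0_def)

lemma V0_subset_Wm: "V0 n l m \<subseteq> Wm n l m"
  by (auto simp: V0_iff)

lemma lincomb_closed_V0: "lincomb_closed (V0 n l m)"
  unfolding lincomb_closed_def
proof (intro conjI ballI allI)
  show "(\<lambda>t. 0) \<in> V0 n l m"
    using lincomb_closed_Wm unfolding lincomb_closed_def by (auto simp: V0_iff vsupp_def)
  fix x y and a c :: complex
  assume xy: "x \<in> V0 n l m" "y \<in> V0 n l m"
  then have "(\<lambda>t. a * x t + c * y t) \<in> Wm n l m"
    by (intro lincomb_closedD[OF lincomb_closed_Wm]) (auto simp: V0_iff)
  moreover have "vsupp (\<lambda>t. a * x t + c * y t) \<subseteq> vsupp x \<union> vsupp y"
    unfolding vsupp_def by auto
  ultimately show "(\<lambda>t. a * x t + c * y t) \<in> V0 n l m"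
    using xy unfolding V0_iff by blast
qed

lemma basis_vec_V0_iff: "basis_vec b \<in> V0 n l m \<longleftrightarrow> b \<in> basisW n l m \<and> snd b = replicate m 0"
  unfolding V0_iff basis_vec_Wm_iff vsupp_basis_vec by simp

lemma basis_vec_V0: "(ys, replicate m 0) \<in> basisW n l m \<Longrightarrow> basis_vec (ys, replicate m 0) \<in> V0 n l m"
  unfolding V0_iff basis_vec_Wm_iff vsupp_basis_vec by simp

lemma lin_on_eq_on_V0:
  assumes "lin_on (V0 n l m) F" "lin_on (V0 n l m) G"
    "\<And>ys. (ys, replicate m 0) \<in> basisW n l m \<Longrightarrow> F (basis_vec (ys, replicate m 0)) = G (basis_vec (ys, replicate m 0))"
    "v \<in> V0 n l m"
  shows "F v = G v"
proof (rule lin_on_eq_on_basis_vecs[OF lincomb_closed_V0 _ _ assms(1,2) _ assms(4)])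
  show "finite (vsupp w)" if "w \<in> V0 n l m" for w
    using that by (simp add: V0_iff Wm_iff)
  show "basis_vec b \<in> V0 n l m" if "w \<in> V0 n l m" "b \<in> vsupp w" for w b
  proof -
    from that have "b \<in> basisW n l m" "snd b = replicate m 0" by (auto simp: V0_iff Wm_iff)
    then show ?thesis by (simp add: basis_vec_V0_iff)
  qed
  show "F (basis_vec b) = G (basis_vec b)" if "basis_vec b \<in> V0 n l m" for b
    using that assms(3)[of "fst b"] unfolding basis_vec_V0_iff by (metis prod.collapse)
qed

section \<open>The action of the generators\<close>

lemma act_lincomb:
  "act m i j k (\<lambda>t. \<Sum>b\<in>F. a b * f b t) = (\<lambda>t. \<Sum>b\<in>F. a b * act m i j k (f b) t)"
proof
  fix t :: idx
  obtain xs ks where t: "t = (xs, ks)" by (cases t)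
  define C where "C p \<longleftrightarrow> xs ! p = i \<and> k \<le> ks ! p" for p
  define u where "u p = (xs[p := j], ks[p := ks ! p - k])" for p
  have "act m i j k (\<lambda>t. \<Sum>b\<in>F. a b * f b t) t = (\<Sum>p<m. if C p then \<Sum>b\<in>F. a b * f b (u p) else 0)"
    by (simp only: t act_def C_def u_def prod.case)
  also have "\<dots> = (\<Sum>p<m. \<Sum>b\<in>F. a b * (if C p then f b (u p) else 0))"
    by (rule sum.cong[OF refl]) simp
  also have "\<dots> = (\<Sum>b\<in>F. \<Sum>p<m. a b * (if C p then f b (u p) else 0))"
    by (rule sum.swap)
  also have "\<dots> = (\<Sum>b\<in>F. a b * (\<Sum>p<m. if C p then f b (u p) else 0))"
    by (simp only: sum_distrib_left)
  also have "\<dots> = (\<Sum>b\<in>F. a b * act m i j k (f b) t)"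
    by (simp only: t act_def C_def u_def prod.case)
  finally show "act m i j k (\<lambda>t. \<Sum>b\<in>F. a b * f b t) t = (\<Sum>b\<in>F. a b * act m i j k (f b) t)" .
qed

lemma lin_on_act: "lin_on A (act m i j k)"
  unfolding lin_on_def
proof (intro ballI allI ext)
  fix x y :: "idx \<Rightarrow> complex" and t :: idx and a c :: complex
  obtain xs ks where t: "t = (xs, ks)" by (cases t)
  define C where "C p \<longleftrightarrow> xs ! p = i \<and> k \<le> ks ! p" for p
  define u where "u p = (xs[p := j], ks[p := ks ! p - k])" for p
  have "act m i j k (\<lambda>t. a * x t + c * y t) t = (\<Sum>p<m. if C p then a * x (u p) + c * y (u p) else 0)"
    by (simp only: t act_def C_def u_def prod.case)
  also have "\<dots> = (\<Sum>p<m. a * (if C p then x (u p) else 0) + c * (if C p then y (u p) else 0))"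
    by (rule sum.cong[OF refl]) simp
  also have "\<dots> = a * act m i j k x t + c * act m i j k y t"
    by (simp only: t act_def C_def u_def prod.case sum.distrib sum_distrib_left)
  finally show "act m i j k (\<lambda>t. a * x t + c * y t) t = a * act m i j k x t + c * act m i j k y t" .
qed

lemma list_update_eq_iff:
  "p < length ys \<Longrightarrow> (xs[p := a] = ys \<and> xs ! p = b) \<longleftrightarrow> (ys ! p = a \<and> xs = ys[p := b])"
  by (auto simp: nth_list_update)

lemma list_update_diff_eq_iff:
  "p < length ls \<Longrightarrow> (ks[p := ks ! p - k] = (ls :: nat list) \<and> k \<le> ks ! p) \<longleftrightarrow> ks = ls[p := ls ! p + k]"
  by (auto simp: nth_list_update)

lemma act_basis_vec:
  assumes "length ys = m" "length ls = m"
  shows "act m i j k (basis_vec (ys, ls)) =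
    (\<lambda>t. \<Sum>p<m. (if ys ! p = j then 1 else 0) * basis_vec (ys[p := i], ls[p := ls ! p + k]) t)"
proof
  fix t :: idx
  obtain xs ks where t: "t = (xs, ks)" by (cases t)
  have coeff: "(if xs ! p = i \<and> k \<le> ks ! p then basis_vec (ys, ls) (xs[p := j], ks[p := ks ! p - k]) else 0)
     = (if ys ! p = j then 1 else 0) * basis_vec (ys[p := i], ls[p := ls ! p + k]) (xs, ks)"
    if "p < m" for p
  proof -
    have "(if xs ! p = i \<and> k \<le> ks ! p then basis_vec (ys, ls) (xs[p := j], ks[p := ks ! p - k]) else 0)
       = (if (xs[p := j] = ys \<and> xs ! p = i) \<and> (ks[p := ks ! p - k] = ls \<and> k \<le> ks ! p) then 1 else 0)"
      by (auto simp: basis_vec_def)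
    also have "\<dots> = (if ys ! p = j \<and> (xs, ks) = (ys[p := i], ls[p := ls ! p + k]) then 1 else 0)"
      using that assms by (simp only: list_update_eq_iff list_update_diff_eq_iff prod.inject conj_assoc)
    also have "\<dots> = (if ys ! p = j then 1 else 0) * basis_vec (ys[p := i], ls[p := ls ! p + k]) (xs, ks)"
      by (simp add: basis_vec_def)
    finally show ?thesis .
  qed
  show "act m i j k (basis_vec (ys, ls)) t = (\<Sum>p<m. (if ys ! p = j then 1 else 0) * basis_vec (ys[p := i], ls[p := ls ! p + k]) t)"
    unfolding t act_def prod.case by (rule sum.cong[OF refl], rule coeff) simp
qed

lemma act_basis_vec_unique:
  assumes "(ys, ls) \<in> basisW n l m" "p < m" "\<And>r. r < m \<Longrightarrow> r \<noteq> p \<Longrightarrow> ys ! r \<noteq> ys ! p"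
  shows "act m i (ys ! p) k (basis_vec (ys, ls)) = basis_vec (ys[p := i], ls[p := ls ! p + k])"
proof -
  have "(\<Sum>r<m. (if ys ! r = ys ! p then 1 else 0) * basis_vec (ys[r := i], ls[r := ls ! r + k]) t)
      = basis_vec (ys[p := i], ls[p := ls ! p + k]) t" for t
    using assms(2,3) by (subst sum.remove[of _ p]) auto
  then show ?thesis using assms(1) by (simp add: act_basis_vec basisW_iff)
qed

lemma act_Wm:
  assumes "w \<in> Wm n l m" "1 \<le> i" "i \<le> n * l"
  shows "act m i j k w \<in> Wm n l m"
proof -
  have "act m i j k (basis_vec (ys, ls)) \<in> Wm n l m" if "(ys, ls) \<in> basisW n l m" for ys ls
    using that assms(2,3)
    by (auto simp: act_basis_vec basisW_iff intro!: lincomb_closed_sum[OF lincomb_closed_Wm]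
             basis_vec_Wm basisW_update)
  then have "(\<lambda>t. \<Sum>b\<in>vsupp w. w b * act m i j k (basis_vec b) t) \<in> Wm n l m"
    by (intro lincomb_closed_vsupp_sum[OF assms(1) lincomb_closed_Wm]) auto
  then show ?thesis
    by (subst Wm_expansion[OF assms(1)]) (simp add: act_lincomb)
qed

lemma replicate_update_same [simp]: "(replicate m x)[p := x] = replicate m x"
  by (metis list_update_beyond list_update_id not_le_imp_less nth_replicate length_replicate)

lemma act_V0:
  assumes "v \<in> V0 n l m" "1 \<le> i" "i \<le> n * l"
  shows "act m i j 0 v \<in> V0 n l m"
proof -
  have act_basis: "act m i j 0 (basis_vec (ys, replicate m 0)) \<in> V0 n l m"
    if "(ys, replicate m 0) \<in> basisW n l m" for ys
  proof -
    have "(ys[p := i], replicate m 0) \<in> basisW n l m" for p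
      using basisW_update[OF that assms(2,3), of p 0] by simp
    then show ?thesis
      using that by (auto simp: act_basis_vec basisW_iff intro!: lincomb_closed_sum[OF lincomb_closed_V0] basis_vec_V0)
  qed
  have v: "v \<in> Wm n l m" "\<And>b. b \<in> vsupp v \<Longrightarrow> (fst b, replicate m 0) = b \<and> b \<in> basisW n l m"
    using assms(1) by (auto simp: V0_iff Wm_iff)
  have "(\<lambda>t. \<Sum>b\<in>vsupp v. v b * act m i j 0 (basis_vec b) t) \<in> V0 n l m"
  proof (intro lincomb_closed_sum[OF lincomb_closed_V0])
    show "finite (vsupp v)" using v(1) by (simp add: Wm_iff)
    show "act m i j 0 (basis_vec b) \<in> V0 n l m" if "b \<in> vsupp v" for b
      using act_basis v(2)[OF that] by metis
  qed
  then show ?thesis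
    by (subst Wm_expansion[OF v(1)]) (simp add: act_lincomb)
qed

lemma act_diag:
  "act m i i 0 w (xs, ks) = of_nat (card {p. p < m \<and> xs ! p = i}) * w (xs, ks)"
proof -
  have "act m i i 0 w (xs, ks) = (\<Sum>p<m. if xs ! p = i then w (xs, ks) else 0)"
    unfolding act_def prod.case by (rule sum.cong[OF refl]) auto
  also have "\<dots> = of_nat (card {p. p < m \<and> xs ! p = i}) * w (xs, ks)"
    by (simp add: sum.If_cases Int_def conj_commute)
  finally show ?thesis .
qed

lemma act_diag_basis_vec:
  "act m i i 0 (basis_vec (V, ks)) = (\<lambda>t. of_nat (card {p. p < m \<and> V ! p = i}) * basis_vec (V, ks) t)"
proof
  fix t :: idx
  obtain xs ks' where t: "t = (xs, ks')" by (cases t)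
  show "act m i i 0 (basis_vec (V, ks)) t = of_nat (card {p. p < m \<and> V ! p = i}) * basis_vec (V, ks) t"
    unfolding t act_diag by (simp add: basis_vec_def)
qed

lemma card_nth_eq_count: "card {p. p < length xs \<and> xs ! p = i} = count (mset xs) i"
  by (simp add: count_mset count_list_eq_length_filter length_filter_conv_card eq_commute)

lemma gl_gen_p_gen: "gl_gen n l i j \<Longrightarrow> p_gen n l i j 0"
  unfolding gl_gen_def p_gen_def by simp

lemma EndP_act: "T \<in> EndP n l m \<Longrightarrow> p_gen n l i j k \<Longrightarrow> w \<in> Wm n l m \<Longrightarrow> T (act m i j k w) = act m i j k (T w)"
  unfolding EndP_def by blast

lemma HomG_Wm: "S \<in> HomG n l m \<Longrightarrow> v \<in> V0 n l m \<Longrightarrow> S v \<in> Wm n l m"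
  unfolding HomG_def by blast

section \<open>Blocks and colours\<close>

lemma blk_eq:
  assumes "0 < n" "1 \<le> i"
  shows "blk n i = (i - 1) div n + 1"
proof -
  define q where "q = (i - 1) div n"
  have "q * n \<le> i - 1" "i - 1 < (q + 1) * n"
    using dividend_less_div_times[OF assms(1), of "i - 1"] unfolding q_def by simp_all
  then have "real (q + 1) - 1 < real i / real n" "real i / real n \<le> real (q + 1)"
    using assms by (simp_all add: field_simps flip: of_nat_mult)
  then have "\<lceil>real i / real n\<rceil> = int (q + 1)"
    by (simp add: ceiling_eq_iff)
  then show ?thesis unfolding blk_def q_def by simp
qed

lemma blk_range:
  assumes "0 < n" "1 \<le> i" "i \<le> n * l"
  shows "1 \<le> blk n i" "blk n i \<le> l"
proof -
  have "(i - 1) div n < l"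
    using assms by (simp add: div_less_iff_less_mult mult.commute)
  then show "1 \<le> blk n i" "blk n i \<le> l"
    using assms(1,2) by (simp_all add: blk_eq)
qed

lemma blk_block_index:
  assumes "p < n"
  shows "blk n (c * n + p + 1) = c + 1"
  using assms by (simp add: blk_eq)

lemma fresh_index_in_block:
  assumes "0 < n" "1 \<le> \<beta>" "\<beta> \<le> l" "finite X" "card X < n"
  obtains j where "1 \<le> j" "j \<le> n * l" "blk n j = \<beta>" "j \<notin> X"
proof -
  define B where "B = (\<lambda>p. (\<beta> - 1) * n + p + 1) ` {..<n}"
  have "card B = n"
    unfolding B_def by (subst card_image) (auto simp: inj_on_def)
  then have "\<not> B \<subseteq> X"
    using assms(4,5) card_mono[of X B] by linarith
  then obtain j where j: "j \<in> B" "j \<notin> X"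
    by blast
  then obtain p where p: "p < n" "j = (\<beta> - 1) * n + p + 1"
    unfolding B_def by blast
  have "(\<beta> - 1) * n + p + 1 \<le> (\<beta> - 1) * n + n"
    using p(1) by simp
  also have "\<dots> = \<beta> * n"
    using assms(2) by (cases \<beta>) simp_all
  also have "\<dots> \<le> n * l"
    using assms(3) by (simp add: mult.commute)
  finally have "(\<beta> - 1) * n + p + 1 \<le> n * l" .
  moreover have "blk n j = \<beta>"
    using p assms(2) blk_block_index[of p n "\<beta> - 1"] by simp
  ultimately show ?thesis
    using p(2) j(2) by (intro that[of j]) simp_all
qed

definition color :: "nat \<Rightarrow> nat \<Rightarrow> nat \<Rightarrow> nat \<Rightarrow> nat" where
  "color n l i k = (blk n i + k - 1) mod l"

lemma color_p_gen:
  assumes "p_gen n l i j k" "0 < n"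
  shows "color n l i (a + k) = color n l j a"
proof -
  have "1 \<le> blk n i" "1 \<le> blk n j"
    using assms blk_range unfolding p_gen_def by blast+
  moreover have "int l dvd int (blk n i) - int (blk n j) + int k"
    using assms(1) unfolding p_gen_def by presburger
  ultimately have "int (blk n i + (a + k) - 1) mod int l = int (blk n j + a - 1) mod int l"
    by (simp add: mod_eq_dvd_iff algebra_simps)
  then show ?thesis
    unfolding color_def by (simp flip: of_nat_mod)
qed

lemma p_gen_of_color:
  assumes "0 < n" "1 \<le> i" "i \<le> n * l" "1 \<le> j" "j \<le> n * l" "color n l i k = color n l j 0"
  shows "p_gen n l i j k"
proof -
  have "1 \<le> blk n i" "1 \<le> blk n j"
    using assms blk_range by blast+
  moreover have "int (blk n i + k - 1) mod int l = int (blk n j + 0 - 1) mod int l"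
    using arg_cong[OF assms(6), of int] unfolding color_def by (simp only: of_nat_mod)
  ultimately have "int l dvd int (blk n i) - int (blk n j) + int k"
    by (simp add: mod_eq_dvd_iff algebra_simps)
  then show ?thesis
    using assms(2-5) unfolding p_gen_def by presburger
qed

section \<open>The restriction map and its injectivity\<close>

lemma restrict_EndP_HomG:
  assumes T: "T \<in> EndP n l m"
  shows "restrict T (V0 n l m) \<in> HomG n l m"
  unfolding HomG_def mem_Collect_eq
proof (intro conjI allI impI ballI)
  show "restrict T (V0 n l m) \<in> extensional (V0 n l m)" by simp
  show "lin_on (V0 n l m) (restrict T (V0 n l m))"
    using T by (intro lin_on_restrict[OF _ V0_subset_Wm lincomb_closed_V0]) (simp add: EndP_def)
  show "restrict T (V0 n l m) v \<in> Wm n l m" if "v \<in> V0 n l m" for v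
    using T that subsetD[OF V0_subset_Wm that] unfolding EndP_def by auto
  fix i j v assume ijv: "gl_gen n l i j \<and> v \<in> V0 n l m"
  then have "act m i j 0 v \<in> V0 n l m"
    by (intro act_V0) (simp_all add: gl_gen_def)
  then show "restrict T (V0 n l m) (act m i j 0 v) = act m i j 0 (restrict T (V0 n l m) v)"
    using EndP_act[OF T gl_gen_p_gen] ijv subsetD[OF V0_subset_Wm] by auto
qed

lemma basis_vec_from_degree_zero_at:
  assumes "0 < n" "m \<le> n" "0 < l" "(xs, ks) \<in> basisW n l m" "p < m"
  obtains j where "p_gen n l (xs ! p) j (ks ! p)" "(xs[p := j], ks[p := 0]) \<in> basisW n l m"
    "act m (xs ! p) j (ks ! p) (basis_vec (xs[p := j], ks[p := 0])) = basis_vec (xs, ks)"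
proof -
  have len: "length xs = m" "length ks = m" and rng: "1 \<le> xs ! p" "xs ! p \<le> n * l"
    using assms(4,5) by (auto simp: basisW_iff)
  define \<beta> where "\<beta> = color n l (xs ! p) (ks ! p) + 1"
  define X where "X = (\<lambda>r. xs ! r) ` ({..<m} - {p})"
  have "card X \<le> card ({..<m} - {p})"
    unfolding X_def by (rule card_image_le) simp
  then have "card X < n"
    using assms(2,5) by simp
  moreover have "1 \<le> \<beta>" "\<beta> \<le> l"
    using assms(3) unfolding \<beta>_def color_def by (simp_all add: Suc_le_eq)
  moreover have "finite X" unfolding X_def by simp
  ultimately obtain j where j: "1 \<le> j" "j \<le> n * l" "blk n j = \<beta>" "j \<notin> X"
    using fresh_index_in_block[OF assms(1), of \<beta> l X] by blast
  have "color n l j 0 = color n l (xs ! p) (ks ! p)"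
    using j(3) unfolding \<beta>_def color_def by simp
  then have pg: "p_gen n l (xs ! p) j (ks ! p)"
    using p_gen_of_color[OF assms(1) rng j(1,2)] by simp
  have b: "(xs[p := j], ks[p := 0]) \<in> basisW n l m"
    by (rule basisW_update[OF assms(4) j(1,2)])
  have "xs[p := j] ! r \<noteq> xs[p := j] ! p" if "r < m" "r \<noteq> p" for r
    using that j(4) assms(5) len unfolding X_def by auto
  then have "act m (xs ! p) j (ks ! p) (basis_vec (xs[p := j], ks[p := 0])) = basis_vec (xs, ks)"
    using act_basis_vec_unique[OF b assms(5), of "xs ! p" "ks ! p"] assms(5) len by simp
  with pg b show ?thesis by (rule that)
qed

lemma EndP_eq_on_basis_vecs:
  assumes "0 < n" "m \<le> n" "0 < l" "T1 \<in> EndP n l m" "T2 \<in> EndP n l m"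
    and eq: "restrict T1 (V0 n l m) = restrict T2 (V0 n l m)"
  shows "(xs, ks) \<in> basisW n l m \<Longrightarrow> T1 (basis_vec (xs, ks)) = T2 (basis_vec (xs, ks))"
proof (induction "sum_list ks" arbitrary: xs ks rule: less_induct)
  case less
  show ?case
  proof (cases "\<forall>k\<in>set ks. k = 0")
    case True
    then have "ks = replicate m 0"
      using less.prems by (auto simp: basisW_iff intro: replicate_eqI)
    then have "basis_vec (xs, ks) \<in> V0 n l m"
      using less.prems basis_vec_V0 by simp
    then show ?thesis using fun_cong[OF eq, of "basis_vec (xs, ks)"] by simp
  next
    case False
    then obtain p where p: "p < m" "ks ! p \<noteq> 0"
      using less.prems by (auto simp: basisW_iff in_set_conv_nth)
    obtain j where j: "p_gen n l (xs ! p) j (ks ! p)" "(xs[p := j], ks[p := 0]) \<in> basisW n l m"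
      "act m (xs ! p) j (ks ! p) (basis_vec (xs[p := j], ks[p := 0])) = basis_vec (xs, ks)"
      using basis_vec_from_degree_zero_at[OF assms(1-3) less.prems p(1)] by blast
    have "p < length ks" using p(1) less.prems by (simp add: basisW_iff)
    then have "sum_list (ks[p := 0]) < sum_list ks"
      using p(2) elem_le_sum_list[of p ks] by (simp add: sum_list_update)
    then have IH: "T1 (basis_vec (xs[p := j], ks[p := 0])) = T2 (basis_vec (xs[p := j], ks[p := 0]))"
      using less.hyps j(2) by blast
    show ?thesis
      using EndP_act[OF assms(4) j(1) basis_vec_Wm[OF j(2)]] EndP_act[OF assms(5) j(1) basis_vec_Wm[OF j(2)]]
      unfolding j(3) IH by simp
  qed
qed

lemma inj_on_restrict_EndP:
  assumes "0 < n" "m \<le> n" "0 < l"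
  shows "inj_on (\<lambda>T. restrict T (V0 n l m)) (EndP n l m)"
proof (rule inj_onI)
  fix T1 T2 assume T: "T1 \<in> EndP n l m" "T2 \<in> EndP n l m"
    and eq: "restrict T1 (V0 n l m) = restrict T2 (V0 n l m)"
  have "T1 w = T2 w" if "w \<in> Wm n l m" for w
  proof (rule lin_on_eq_on_Wm[OF _ _ _ that])
    show "lin_on (Wm n l m) T1" "lin_on (Wm n l m) T2"
      using T by (simp_all add: EndP_def)
    show "T1 (basis_vec b) = T2 (basis_vec b)" if "b \<in> basisW n l m" for b
      using EndP_eq_on_basis_vecs[OF assms T eq] that by (cases b) simp
  qed
  moreover have "T1 \<in> extensional (Wm n l m)" "T2 \<in> extensional (Wm n l m)"
    using T by (simp_all add: EndP_def)
  ultimately show "T1 = T2"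
    using extensionalityI by blast
qed

section \<open>Canonical vectors generate the degree-zero part\<close>

definition canon :: "nat \<Rightarrow> nat \<Rightarrow> idx \<Rightarrow> nat list" where
  "canon n l b = map (\<lambda>p. color n l (fst b ! p) (snd b ! p) * n + p + 1) [0..<length (fst b)]"

lemma length_canon [simp]: "length (canon n l b) = length (fst b)"
  unfolding canon_def by simp

lemma nth_canon: "p < length (fst b) \<Longrightarrow> canon n l b ! p = color n l (fst b ! p) (snd b ! p) * n + p + 1"
  unfolding canon_def by simp

lemma blk_canon:
  assumes "p < length (fst b)" "length (fst b) \<le> n"
  shows "blk n (canon n l b ! p) = color n l (fst b ! p) (snd b ! p) + 1"
  using assms blk_block_index[of p n "color n l (fst b ! p) (snd b ! p)"] by (simp add: nth_canon)

lemma distinct_canon: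
  assumes "length (fst b) \<le> n"
  shows "distinct (canon n l b)"
proof -
  have "(canon n l b ! p - 1) mod n = p" if "p < length (fst b)" for p
    using that assms by (simp add: nth_canon)
  then show ?thesis
    unfolding distinct_conv_nth by (metis length_canon)
qed

lemma canon_basisW:
  assumes "b \<in> basisW n l m" "m \<le> n" "0 < l"
  shows "distinct (canon n l b)" "length (canon n l b) = m" "(canon n l b, replicate m 0) \<in> basisW n l m"
proof -
  have "c * n + p + 1 \<le> n * l" if "c < l" "p < n" for c p
  proof -
    have "c * n + p + 1 \<le> c * n + n"
      using that(2) by simp
    also have "\<dots> \<le> (l - 1) * n + n"
      using that(1) by (intro add_le_mono1 mult_le_mono1) linarith
    also have "\<dots> = n * l"
      using that(1) by (cases l) (simp_all add: algebra_simps)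
    finally show ?thesis .
  qed
  moreover have "length (fst b) = m"
    using assms(1) by (cases b) (simp add: basisW_iff)
  ultimately show "distinct (canon n l b)" "length (canon n l b) = m" "(canon n l b, replicate m 0) \<in> basisW n l m"
    using assms(2,3) distinct_canon[of b n l] unfolding basisW_iff
    by (auto simp: in_set_conv_nth nth_canon color_def)
qed

lemma canon_update:
  assumes "p_gen n l i j k" "0 < n" "ys ! p = j" "length ls = length ys"
  shows "canon n l (ys[p := i], ls[p := ls ! p + k]) = canon n l (ys, ls)"
proof (cases "p < length ys")
  case True
  then show ?thesis
    using assms color_p_gen[OF assms(1,2), of "ls ! p"]
    by (auto simp: canon_def nth_list_update intro!: map_cong)
qed (simp add: list_update_beyond assms(4))

lemma color_canon:
  assumes "p < length (fst b)" "length (fst b) \<le> n" "0 < l"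
  shows "color n l (canon n l b ! p) 0 = color n l (fst b ! p) (snd b ! p)"
  using assms by (simp add: color_def blk_canon)

lemma canon_canon:
  assumes "length (fst b) \<le> n" "0 < l"
  shows "canon n l (canon n l b, replicate (length (fst b)) 0) = canon n l b"
  using assms color_canon[OF _ assms]
  by (auto simp: canon_def intro!: map_cong)

lemma blk_canon_degree_zero:
  assumes "(ys, replicate m 0) \<in> basisW n l m" "p < m" "m \<le> n" "0 < n"
  shows "blk n (canon n l (ys, replicate m 0) ! p) = blk n (ys ! p)"
proof -
  have "1 \<le> blk n (ys ! p)" "blk n (ys ! p) \<le> l"
    using assms blk_range[of n "ys ! p" l] by (auto simp: basisW_iff)
  then show ?thesis
    using assms by (simp add: blk_canon basisW_iff color_def)
qed

lemma act_basis_vec_replace: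
  assumes "length ys = m" "p < m"
  shows "act m (ys ! p) c 0 (basis_vec (ys[p := c], replicate m 0)) =
    (\<lambda>t. basis_vec (ys, replicate m 0) t +
      (\<Sum>r\<in>{r \<in> {..<m} - {p}. ys ! r = c}. basis_vec (ys[p := c, r := ys ! p], replicate m 0) t))"
proof -
  have "(\<Sum>r\<in>{..<m} - {p}. (if ys[p := c] ! r = c then 1 else 0) * basis_vec (ys[p := c, r := ys ! p], replicate m 0) t)
      = (\<Sum>r\<in>{r \<in> {..<m} - {p}. ys ! r = c}. basis_vec (ys[p := c, r := ys ! p], replicate m 0) t)" for t
    by (rule sum.mono_neutral_cong_right) auto
  moreover have "ys[p := c, p := ys ! p] = ys" "ys[p := c] ! p = c"
    using assms by simp_all
  ultimately show ?thesis
    using assms by (simp add: act_basis_vec sum.remove[of "{..<m}" p])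
qed

lemma blk_pattern_update:
  assumes "\<forall>q<m. blk n (u ! q) = blk n (V ! q)" "blk n x = blk n (V ! r)"
  shows "\<forall>q<m. blk n (u[r := x] ! q) = blk n (V ! q)"
  using assms by (cases "r < length u") (auto simp: nth_list_update list_update_beyond)

text \<open>Induction on the number of positions where \<open>ys\<close> differs from \<open>V\<close>: at such a position
  \<open>p\<close>, applying \<open>E\<^bsub>ys!p, V!p\<^esub>\<close> to \<open>e\<^bsub>ys[p := V!p]\<^esub>\<close> gives \<open>e\<^bsub>ys\<^esub>\<close> plus vectors with
  fewer mismatches, since \<open>V\<close> is distinct.\<close>

lemma basis_vec_in_gl_submodule:
  assumes A: "lincomb_closed A" "\<And>i j v. gl_gen n l i j \<Longrightarrow> v \<in> A \<Longrightarrow> act m i j 0 v \<in> A"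
    and V: "distinct V" "(V, replicate m 0) \<in> basisW n l m" "basis_vec (V, replicate m 0) \<in> A"
  shows "(ys, replicate m 0) \<in> basisW n l m \<Longrightarrow> \<forall>p<m. blk n (ys ! p) = blk n (V ! p)
    \<Longrightarrow> basis_vec (ys, replicate m 0) \<in> A"
proof (induction "card {p. p < m \<and> ys ! p \<noteq> V ! p}" arbitrary: ys rule: less_induct)
  case less
  define z where "z = replicate m (0::nat)"
  define M where "M u = {q. q < m \<and> u ! q \<noteq> V ! q}" for u :: "nat list"
  have ys: "length ys = m" "\<forall>i\<in>set ys. 1 \<le> i \<and> i \<le> n * l"
    using less.prems(1) by (simp_all add: basisW_iff)
  have lV: "length V = m" "\<forall>i\<in>set V. 1 \<le> i \<and> i \<le> n * l"
    using V(2) by (simp_all add: basisW_iff)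
  have IH: "basis_vec (u, z) \<in> A"
    if "M u \<subset> M ys" "(u, z) \<in> basisW n l m" "\<forall>q<m. blk n (u ! q) = blk n (V ! q)" for u
  proof -
    have "card (M u) < card (M ys)"
      using that(1) by (intro psubset_card_mono) (simp_all add: M_def)
    then show ?thesis
      using less.hyps that(2,3) unfolding M_def z_def by blast
  qed
  show ?case
  proof (cases "M ys = {}")
    case True
    then have "ys = V"
      using ys(1) lV(1) by (intro nth_equalityI) (auto simp: M_def)
    then show ?thesis using V(3) by simp
  next
    case False
    then obtain p where p: "p < m" "ys ! p \<noteq> V ! p" by (auto simp: M_def)
    define a where "a = ys ! p"
    define c where "c = V ! p"
    define R where "R = {r \<in> {..<m} - {p}. ys ! r = c}"
    have ac: "1 \<le> a" "a \<le> n * l" "1 \<le> c" "c \<le> n * l" "blk n a = blk n c"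
      using ys lV p(1) less.prems(2) unfolding a_def c_def by auto
    have ys': "(ys[p := c], z) \<in> basisW n l m" "\<forall>q<m. blk n (ys[p := c] ! q) = blk n (V ! q)"
      using basisW_update[OF less.prems(1) ac(3,4), of p 0] blk_pattern_update[OF less.prems(2)]
      unfolding z_def c_def by simp_all
    have "M (ys[p := c]) \<subset> M ys"
      using p ys(1) unfolding M_def c_def by (auto simp: nth_list_update)
    then have "act m a c 0 (basis_vec (ys[p := c], z)) \<in> A"
      using IH ys' A(2) ac unfolding gl_gen_def by blast
    moreover have "basis_vec (ys[p := c, r := a], z) \<in> A" if "r \<in> R" for r
    proof (rule IH)
      have "r < m" "r \<noteq> p" "ys ! r = V ! p" using that unfolding R_def c_def by auto
      moreover have "V ! r \<noteq> V ! p" using calculation lV(1) p(1) V(1) by (simp add: nth_eq_iff_index_eq)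
      ultimately show "M (ys[p := c, r := a]) \<subset> M ys"
        using p ys(1) unfolding M_def c_def by (auto simp: nth_list_update)
      show "(ys[p := c, r := a], z) \<in> basisW n l m"
        using basisW_update[OF ys'(1) ac(1,2), of r 0] unfolding z_def by simp
      show "\<forall>q<m. blk n (ys[p := c, r := a] ! q) = blk n (V ! q)"
        using blk_pattern_update[OF ys'(2), of a r] that ac(5) less.prems(2) unfolding R_def c_def by auto
    qed
    then have "(\<lambda>t. \<Sum>r\<in>R. basis_vec (ys[p := c, r := a], z) t) \<in> A"
      using lincomb_closed_sum[OF A(1), of R _ "\<lambda>_. 1"] by (simp add: R_def)
    ultimately have "(\<lambda>t. 1 * act m a c 0 (basis_vec (ys[p := c], z)) t +
        (- 1) * (\<Sum>r\<in>R. basis_vec (ys[p := c, r := a], z) t)) \<in> A"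
      by (rule lincomb_closedD[OF A(1)])
    then show ?thesis
      using act_basis_vec_replace[OF ys(1) p(1), of c] unfolding a_def R_def z_def by simp
  qed
qed

lemma HomG_eqI:
  assumes S1: "S1 \<in> HomG n l m" and S2: "S2 \<in> HomG n l m" and "0 < n" "m \<le> n" "0 < l"
    and canon_eq: "\<And>ys. (ys, replicate m 0) \<in> basisW n l m \<Longrightarrow>
      S1 (basis_vec (canon n l (ys, replicate m 0), replicate m 0)) = S2 (basis_vec (canon n l (ys, replicate m 0), replicate m 0))"
  shows "S1 = S2"
proof -
  have hom: "lin_on (V0 n l m) S1" "lin_on (V0 n l m) S2"
    "\<And>i j v. gl_gen n l i j \<Longrightarrow> v \<in> V0 n l m \<Longrightarrow> S1 (act m i j 0 v) = act m i j 0 (S1 v)"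
    "\<And>i j v. gl_gen n l i j \<Longrightarrow> v \<in> V0 n l m \<Longrightarrow> S2 (act m i j 0 v) = act m i j 0 (S2 v)"
    using S1 S2 unfolding HomG_def by blast+
  define A where "A = {v \<in> V0 n l m. S1 v = S2 v}"
  have A_closed: "lincomb_closed A"
    unfolding lincomb_closed_def
  proof (intro conjI ballI allI)
    show "(\<lambda>t. 0) \<in> A"
      using lincomb_closed_V0 lin_on_zero[OF lincomb_closed_V0 hom(1)] lin_on_zero[OF lincomb_closed_V0 hom(2)]
      unfolding A_def lincomb_closed_def by simp
    fix x y a c assume "x \<in> A" "y \<in> A"
    then show "(\<lambda>t. a * x t + c * y t) \<in> A"
      using lincomb_closedD[OF lincomb_closed_V0] lin_onD[OF hom(1)] lin_onD[OF hom(2)]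
      unfolding A_def by simp
  qed
  have A_act: "act m i j 0 v \<in> A" if "gl_gen n l i j" "v \<in> A" for i j v
    using that act_V0[of v n l m i j] hom(3,4) unfolding A_def by (auto simp: gl_gen_def)
  have A_basis: "basis_vec (ys, replicate m 0) \<in> A" if ys: "(ys, replicate m 0) \<in> basisW n l m" for ys
  proof -
    define V where "V = canon n l (ys, replicate m 0)"
    note V = canon_basisW[OF ys assms(4,5), folded V_def]
    have "basis_vec (V, replicate m 0) \<in> A"
      using canon_eq[OF ys] basis_vec_V0[OF V(3)] unfolding A_def V_def by simp
    moreover have "\<forall>p<m. blk n (ys ! p) = blk n (V ! p)"
      using blk_canon_degree_zero[OF ys _ assms(4,3)] unfolding V_def by simp
    ultimately show ?thesis
      using basis_vec_in_gl_submodule[OF A_closed A_act V(1,3)] ys by blast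
  qed
  have "S1 v = S2 v" if "v \<in> V0 n l m" for v
    using hom(1,2) _ that by (rule lin_on_eq_on_V0) (use A_basis in \<open>simp add: A_def\<close>)
  moreover have "S1 \<in> extensional (V0 n l m)" "S2 \<in> extensional (V0 n l m)"
    using S1 S2 by (simp_all add: HomG_def)
  ultimately show ?thesis
    by (intro extensionalityI[of S1 "V0 n l m" S2])
qed

text \<open>Compare the eigenvalues of the diagonal generators \<open>E\<^bsub>ii\<^esub>\<close> on \<open>e\<^sub>V\<close> and on \<open>S e\<^sub>V\<close>.\<close>

lemma HomG_support_mset:
  assumes S: "S \<in> HomG n l m" and V: "(V, replicate m 0) \<in> basisW n l m"
    and nz: "S (basis_vec (V, replicate m 0)) (xs, ks) \<noteq> 0"
  shows "mset xs = mset V"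
proof (rule multiset_eqI)
  fix i
  define X where "X = S (basis_vec (V, replicate m 0))"
  have e: "basis_vec (V, replicate m 0) \<in> V0 n l m"
    using V by (rule basis_vec_V0)
  have "(xs, ks) \<in> basisW n l m"
    using S e nz unfolding X_def HomG_def Wm_iff vsupp_def by blast
  then have lengths: "length xs = m" "length V = m" and ranges: "\<forall>i\<in>set xs. 1 \<le> i \<and> i \<le> n * l" "\<forall>i\<in>set V. 1 \<le> i \<and> i \<le> n * l"
    using V by (simp_all add: basisW_iff)
  show "count (mset xs) i = count (mset V) i"
  proof (cases "1 \<le> i \<and> i \<le> n * l")
    case True
    then have "gl_gen n l i i" by (simp add: gl_gen_def)
    then have "act m i i 0 X = S (act m i i 0 (basis_vec (V, replicate m 0)))"
      using S e unfolding X_def HomG_def by simp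
    also have "\<dots> = (\<lambda>t. of_nat (card {p. p < m \<and> V ! p = i}) * X t)"
      unfolding act_diag_basis_vec X_def using S e by (intro lin_on_scale) (simp_all add: HomG_def)
    finally have "of_nat (card {p. p < m \<and> xs ! p = i}) * X (xs, ks) = of_nat (card {p. p < m \<and> V ! p = i}) * X (xs, ks)"
      by (metis act_diag)
    then have "card {p. p < m \<and> xs ! p = i} = card {p. p < m \<and> V ! p = i}"
      using nz unfolding X_def by simp
    then show ?thesis
      using lengths by (simp flip: card_nth_eq_count)
  next
    case False
    then show ?thesis using ranges by (metis count_eq_zero_iff set_mset_mset)
  qed
qed

section \<open>Relabelling\<close>

text \<open>For distinct \<open>V\<close>, the coefficient form of the linear map sending \<open>e\<^bsub>\<sigma>V\<^esub> z\<^sup>c\<close> to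
  \<open>e\<^bsub>\<sigma>(fst b)\<^esub> z\<^bsup>c+\<sigma>(snd b)\<^esup>\<close> and killing the other basis vectors.\<close>

definition relabel :: "nat list \<Rightarrow> idx \<Rightarrow> (idx \<Rightarrow> complex) \<Rightarrow> idx \<Rightarrow> complex" where
  "relabel V b w = (\<lambda>(xs, ks). \<Sum>\<sigma> | \<sigma> permutes {..<length V}.
     if xs = permute_list \<sigma> (fst b) \<and> list_all2 (\<le>) (permute_list \<sigma> (snd b)) ks
     then w (permute_list \<sigma> V, map2 (-) ks (permute_list \<sigma> (snd b))) else 0)"

lemma relabel_lincomb:
  "relabel V b (\<lambda>t. \<Sum>s\<in>F. a s * f s t) = (\<lambda>t. \<Sum>s\<in>F. a s * relabel V b (f s) t)"
proof
  fix t :: idx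
  obtain xs ks where t: "t = (xs, ks)" by (cases t)
  define C where "C \<sigma> \<longleftrightarrow> xs = permute_list \<sigma> (fst b) \<and> list_all2 (\<le>) (permute_list \<sigma> (snd b)) ks" for \<sigma>
  define u where "u \<sigma> = (permute_list \<sigma> V, map2 (-) ks (permute_list \<sigma> (snd b)))" for \<sigma>
  define P where "P = {\<sigma>. \<sigma> permutes {..<length V}}"
  have "relabel V b (\<lambda>t. \<Sum>s\<in>F. a s * f s t) t = (\<Sum>\<sigma>\<in>P. if C \<sigma> then \<Sum>s\<in>F. a s * f s (u \<sigma>) else 0)"
    by (simp only: t relabel_def C_def u_def P_def prod.case)
  also have "\<dots> = (\<Sum>\<sigma>\<in>P. \<Sum>s\<in>F. a s * (if C \<sigma> then f s (u \<sigma>) else 0))"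
    by (rule sum.cong[OF refl]) simp
  also have "\<dots> = (\<Sum>s\<in>F. \<Sum>\<sigma>\<in>P. a s * (if C \<sigma> then f s (u \<sigma>) else 0))"
    by (rule sum.swap)
  also have "\<dots> = (\<Sum>s\<in>F. a s * relabel V b (f s) t)"
    by (simp only: t relabel_def C_def u_def P_def prod.case sum_distrib_left)
  finally show "relabel V b (\<lambda>t. \<Sum>s\<in>F. a s * f s t) t = (\<Sum>s\<in>F. a s * relabel V b (f s) t)" .
qed

lemma permute_list_eq_iff:
  assumes "distinct V" "\<sigma> permutes {..<length V}" "\<tau> permutes {..<length V}"
  shows "permute_list \<sigma> V = permute_list \<tau> V \<longleftrightarrow> \<sigma> = \<tau>"
proof
  assume eq: "permute_list \<sigma> V = permute_list \<tau> V"
  show "\<sigma> = \<tau>"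
  proof
    fix r
    show "\<sigma> r = \<tau> r"
    proof (cases "r < length V")
      case True
      then have "V ! \<sigma> r = V ! \<tau> r"
        using eq assms(2,3) by (metis permute_list_nth)
      moreover have "\<sigma> r < length V" "\<tau> r < length V"
        using True assms(2,3) by (auto dest: permutes_in_image)
      ultimately show ?thesis
        using assms(1) by (simp add: nth_eq_iff_index_eq)
    qed (use assms(2,3) in \<open>simp add: permutes_not_in\<close>)
  qed
qed simp

lemma map2_diff_eq_iff:
  "(list_all2 (\<le>) zs ks \<and> map2 (-) ks zs = ks') \<longleftrightarrow> (length ks' = length zs \<and> ks = map2 (+) ks' (zs :: nat list))"
  by (auto simp: list_all2_conv_all_nth intro!: nth_equalityI)

lemma relabel_basis_vec_perm:
  assumes "distinct V" "\<sigma> permutes {..<length V}" "length ls = length V" "length ks' = length V"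
  shows "relabel V (ys, ls) (basis_vec (permute_list \<sigma> V, ks')) =
    basis_vec (permute_list \<sigma> ys, map2 (+) ks' (permute_list \<sigma> ls))"
proof
  fix t :: idx
  obtain xs ks where t: "t = (xs, ks)" by (cases t)
  define C where "C \<tau> \<longleftrightarrow> xs = permute_list \<tau> ys \<and> list_all2 (\<le>) (permute_list \<tau> ls) ks \<and>
    map2 (-) ks (permute_list \<tau> ls) = ks'" for \<tau>
  have "relabel V (ys, ls) (basis_vec (permute_list \<sigma> V, ks')) t =
      (\<Sum>\<tau> | \<tau> permutes {..<length V}. if \<tau> = \<sigma> then (if C \<sigma> then 1 else 0) else 0)"
    unfolding t relabel_def prod.case
  proof (rule sum.cong[OF refl])
    fix \<tau> assume "\<tau> \<in> {\<tau>. \<tau> permutes {..<length V}}"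
    then have "permute_list \<tau> V = permute_list \<sigma> V \<longleftrightarrow> \<tau> = \<sigma>"
      using permute_list_eq_iff[OF assms(1)] assms(2) by blast
    then show "(if xs = permute_list \<tau> (fst (ys, ls)) \<and> list_all2 (\<le>) (permute_list \<tau> (snd (ys, ls))) ks
        then basis_vec (permute_list \<sigma> V, ks') (permute_list \<tau> V, map2 (-) ks (permute_list \<tau> (snd (ys, ls))))
        else 0) = (if \<tau> = \<sigma> then (if C \<sigma> then 1 else 0) else 0)"
      unfolding C_def basis_vec_def by auto
  qed
  also have "\<dots> = (if C \<sigma> then 1 else 0)"
    using assms(2) by (simp add: finite_permutations)
  also have "\<dots> = basis_vec (permute_list \<sigma> ys, map2 (+) ks' (permute_list \<sigma> ls)) t"
    using assms(3,4) unfolding C_def t basis_vec_def by (simp add: map2_diff_eq_iff)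
  finally show "relabel V (ys, ls) (basis_vec (permute_list \<sigma> V, ks')) t =
    basis_vec (permute_list \<sigma> ys, map2 (+) ks' (permute_list \<sigma> ls)) t" .
qed

lemma relabel_basis_vec_other:
  assumes "mset xs' \<noteq> mset V"
  shows "relabel V b (basis_vec (xs', ks')) = (\<lambda>t. 0)"
  using assms unfolding relabel_def basis_vec_def
  by (intro ext) (auto intro!: sum.neutral)

lemma relabel_basis_vec_Wm:
  assumes "distinct V" "length V = m" "(ys, ls) \<in> basisW n l m" "s \<in> basisW n l m"
  shows "relabel V (ys, ls) (basis_vec s) \<in> Wm n l m"
proof -
  obtain xs' ks' where s: "s = (xs', ks')" by (cases s)
  show ?thesis
  proof (cases "mset xs' = mset V")
    case True
    then obtain \<sigma> where \<sigma>: "\<sigma> permutes {..<length V}" "permute_list \<sigma> V = xs'"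
      by (rule mset_eq_permutation)
    have "(permute_list \<sigma> ys, map2 (+) ks' (permute_list \<sigma> ls)) \<in> basisW n l m"
      using assms(2-4) \<sigma>(1) unfolding s basisW_iff by auto
    then show ?thesis
      using assms(1-4) \<sigma> relabel_basis_vec_perm[of V \<sigma> ls ks' ys]
      by (auto simp: s basisW_iff intro: basis_vec_Wm)
  next
    case False
    then show ?thesis
      using lincomb_closed_Wm by (simp add: s relabel_basis_vec_other lincomb_closed_def)
  qed
qed

lemma relabel_Wm:
  assumes "distinct V" "length V = m" "(ys, ls) \<in> basisW n l m" "X \<in> Wm n l m"
  shows "relabel V (ys, ls) X \<in> Wm n l m"
proof -
  have "(\<lambda>t. \<Sum>s\<in>vsupp X. X s * relabel V (ys, ls) (basis_vec s) t) \<in> Wm n l m"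
    using assms by (intro lincomb_closed_vsupp_sum[OF assms(4) lincomb_closed_Wm] relabel_basis_vec_Wm)
  then show ?thesis
    by (subst Wm_expansion[OF assms(4)]) (simp add: relabel_lincomb)
qed

lemma permute_list_list_update:
  assumes "\<sigma> permutes {..<length xs}" "r < length xs"
  shows "permute_list \<sigma> (xs[\<sigma> r := x]) = (permute_list \<sigma> xs)[r := x]"
proof (rule nth_equalityI)
  fix q assume "q < length (permute_list \<sigma> (xs[\<sigma> r := x]))"
  then have "q < length xs" by simp
  moreover have "\<sigma> q = \<sigma> r \<longleftrightarrow> q = r" "\<sigma> r = \<sigma> q \<longleftrightarrow> r = q"
    using permutes_inj[OF assms(1)] by (auto dest: injD)
  moreover have "\<sigma> q < length xs" "\<sigma> r < length xs"
    using permutes_in_image[OF assms(1)] assms(2) calculation(1) by auto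
  ultimately show "permute_list \<sigma> (xs[\<sigma> r := x]) ! q = (permute_list \<sigma> xs)[r := x] ! q"
    using assms by (simp add: permute_list_nth nth_list_update permutes_in_image)
qed simp

lemma map2_list_update_right:
  assumes "r < length xs"
  shows "map2 f xs (ys[r := y]) = (map2 f xs ys)[r := f (xs ! r) y]"
proof (cases "r < length ys")
  case True
  then show ?thesis
    using assms by (intro nth_equalityI) (auto simp: nth_list_update)
qed (simp add: list_update_beyond)

lemma relabel_act_basis_vec_perm:
  assumes "distinct V" "\<sigma> permutes {..<m}" "length V = m" "length ys = m" "length ls = m" "length ks' = m"
  shows "act m i j k (relabel V (ys, ls) (basis_vec (permute_list \<sigma> V, ks'))) =
    (\<lambda>t. \<Sum>p<m. (if ys ! p = j then 1 else 0) *
      relabel V (ys[p := i], ls[p := ls ! p + k]) (basis_vec (permute_list \<sigma> V, ks')) t)"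
proof -
  define zs where "zs = map2 (+) ks' (permute_list \<sigma> ls)"
  have \<sigma>: "\<sigma> permutes {..<length V}" "\<sigma> permutes {..<length ys}" "\<sigma> permutes {..<length ls}"
    using assms(2-5) by simp_all
  have upd: "permute_list \<sigma> (ys[\<sigma> r := i]) = (permute_list \<sigma> ys)[r := i]"
    "map2 (+) ks' (permute_list \<sigma> (ls[\<sigma> r := ls ! \<sigma> r + k])) = zs[r := zs ! r + k]"
    "permute_list \<sigma> ys ! r = ys ! \<sigma> r" if "r < m" for r
    using that assms(4-6) \<sigma>
    by (simp_all add: permute_list_list_update map2_list_update_right zs_def permute_list_nth add.assoc)
  have "act m i j k (relabel V (ys, ls) (basis_vec (permute_list \<sigma> V, ks'))) =
      act m i j k (basis_vec (permute_list \<sigma> ys, zs))"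
    using assms \<sigma>(1) by (simp add: relabel_basis_vec_perm zs_def)
  also have "\<dots> = (\<lambda>t. \<Sum>r<m. (if permute_list \<sigma> ys ! r = j then 1 else 0) *
         basis_vec ((permute_list \<sigma> ys)[r := i], zs[r := zs ! r + k]) t)"
    using assms(4-6) by (intro act_basis_vec) (simp_all add: zs_def)
  also have "\<dots> = (\<lambda>t. \<Sum>r<m. (if ys ! \<sigma> r = j then 1 else 0) *
         basis_vec (permute_list \<sigma> (ys[\<sigma> r := i]), map2 (+) ks' (permute_list \<sigma> (ls[\<sigma> r := ls ! \<sigma> r + k]))) t)"
    by (intro ext sum.cong refl) (simp add: upd)
  also have "\<dots> = (\<lambda>t. \<Sum>p<m. (if ys ! p = j then 1 else 0) *
         basis_vec (permute_list \<sigma> (ys[p := i]), map2 (+) ks' (permute_list \<sigma> (ls[p := ls ! p + k]))) t)"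
    by (intro ext, subst (2) sum.permute[OF assms(2)]) (simp add: comp_def)
  also have "\<dots> = (\<lambda>t. \<Sum>p<m. (if ys ! p = j then 1 else 0) *
      relabel V (ys[p := i], ls[p := ls ! p + k]) (basis_vec (permute_list \<sigma> V, ks')) t)"
    using assms \<sigma>(1) by (simp add: relabel_basis_vec_perm)
  finally show ?thesis .
qed

lemma relabel_act_basis_vec:
  assumes "distinct V" "length V = m" "length ys = m" "length ls = m" "s \<in> basisW n l m"
  shows "act m i j k (relabel V (ys, ls) (basis_vec s)) =
    (\<lambda>t. \<Sum>p<m. (if ys ! p = j then 1 else 0) * relabel V (ys[p := i], ls[p := ls ! p + k]) (basis_vec s) t)"
proof -
  obtain xs' ks' where s: "s = (xs', ks')" "length ks' = m"
    using assms(5) by (cases s) (simp add: basisW_iff)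
  show ?thesis
  proof (cases "mset xs' = mset V")
    case True
    then obtain \<sigma> where "\<sigma> permutes {..<m}" "permute_list \<sigma> V = xs'"
      using assms(2) by (metis mset_eq_permutation)
    then show ?thesis
      using relabel_act_basis_vec_perm[OF assms(1) _ assms(2-4) s(2)] s(1) by blast
  next
    case False
    then show ?thesis
      using act_lincomb[where F = "{}"] by (simp add: s relabel_basis_vec_other)
  qed
qed

lemma relabel_act:
  assumes "distinct V" "length V = m" "length ys = m" "length ls = m" "X \<in> Wm n l m"
  shows "act m i j k (relabel V (ys, ls) X) =
    (\<lambda>t. \<Sum>p<m. (if ys ! p = j then 1 else 0) * relabel V (ys[p := i], ls[p := ls ! p + k]) X t)"
proof -
  define c where "c p = (if ys ! p = j then 1 else 0 :: complex)" for p
  define R where "R p = relabel V (ys[p := i], ls[p := ls ! p + k])" for p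
  have "act m i j k (relabel V (ys, ls) X) =
      (\<lambda>t. \<Sum>s\<in>vsupp X. X s * act m i j k (relabel V (ys, ls) (basis_vec s)) t)"
    by (subst Wm_expansion[OF assms(5)]) (simp add: relabel_lincomb act_lincomb)
  also have "\<dots> = (\<lambda>t. \<Sum>s\<in>vsupp X. X s * (\<Sum>p<m. c p * R p (basis_vec s) t))"
  proof -
    have "act m i j k (relabel V (ys, ls) (basis_vec s)) = (\<lambda>t. \<Sum>p<m. c p * R p (basis_vec s) t)"
      if "s \<in> vsupp X" for s
      using that assms(5) unfolding c_def R_def
      by (intro relabel_act_basis_vec[OF assms(1-4)]) (auto simp: Wm_iff)
    then show ?thesis by (simp cong: sum.cong)
  qed
  also have "\<dots> = (\<lambda>t. \<Sum>p<m. c p * (\<Sum>s\<in>vsupp X. X s * R p (basis_vec s) t))"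
    by (simp add: sum_distrib_left sum.swap[of _ "{..<m}"] algebra_simps)
  also have "\<dots> = (\<lambda>t. \<Sum>p<m. c p * R p X t)"
    by (subst (2) Wm_expansion[OF assms(5)]) (simp add: R_def relabel_lincomb)
  finally show ?thesis unfolding c_def R_def .
qed

lemma relabel_self:
  assumes "distinct V" "length V = m" "X \<in> Wm n l m" "\<And>s. s \<in> vsupp X \<Longrightarrow> mset (fst s) = mset V"
  shows "relabel V (V, replicate m 0) X = X"
proof -
  have "relabel V (V, replicate m 0) (basis_vec s) = basis_vec s" if s_supp: "s \<in> vsupp X" for s
  proof -
    obtain xs' ks' where s: "s = (xs', ks')" "length ks' = m"
      using s_supp assms(3) unfolding Wm_iff by (cases s) (auto simp: basisW_iff)
    obtain \<sigma> where \<sigma>: "\<sigma> permutes {..<length V}" "permute_list \<sigma> V = xs'"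
      using assms(4)[OF s_supp] s(1) by (auto elim: mset_eq_permutation)
    have "permute_list \<sigma> (replicate m 0) = replicate m (0::nat)"
      using \<sigma>(1) assms(2) permutes_in_image[OF \<sigma>(1)]
      by (intro nth_equalityI) (simp_all add: permute_list_nth)
    moreover have "map2 (+) ks' (replicate m 0) = ks'"
      using s(2) by (intro nth_equalityI) simp_all
    ultimately show ?thesis
      using relabel_basis_vec_perm[OF assms(1) \<sigma>(1), of "replicate m 0" ks' V] assms(2) s \<sigma>(2) by simp
  qed
  then show ?thesis
    by (subst (1 2) Wm_expansion[OF assms(3)]) (simp add: relabel_lincomb cong: sum.cong)
qed

section \<open>Surjectivity of the restriction map\<close>

definition linext :: "nat \<Rightarrow> nat \<Rightarrow> nat \<Rightarrow> (idx \<Rightarrow> idx \<Rightarrow> complex) \<Rightarrow> (idx \<Rightarrow> complex) \<Rightarrow> idx \<Rightarrow> complex" where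
  "linext n l m f = restrict (\<lambda>w t. \<Sum>b\<in>vsupp w. w b * f b t) (Wm n l m)"

lemma linext_eq:
  assumes "w \<in> Wm n l m" "finite F" "vsupp w \<subseteq> F"
  shows "linext n l m f w = (\<lambda>t. \<Sum>b\<in>F. w b * f b t)"
proof
  fix t
  show "linext n l m f w t = (\<Sum>b\<in>F. w b * f b t)"
    unfolding linext_def using assms
    by (simp, intro sum.mono_neutral_left) (auto simp: vsupp_def)
qed

lemma lin_on_linext: "lin_on (Wm n l m) (linext n l m f)"
  unfolding lin_on_def
proof (intro ballI allI)
  fix x y and a c :: complex
  assume xy: "x \<in> Wm n l m" "y \<in> Wm n l m"
  define F where "F = vsupp x \<union> vsupp y"
  have F: "finite F" "vsupp x \<subseteq> F" "vsupp y \<subseteq> F" "vsupp (\<lambda>t. a * x t + c * y t) \<subseteq> F"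
    using xy unfolding F_def by (auto simp: Wm_iff vsupp_def)
  have "(\<lambda>t. a * x t + c * y t) \<in> Wm n l m"
    by (rule lincomb_closedD[OF lincomb_closed_Wm xy])
  then show "linext n l m f (\<lambda>t. a * x t + c * y t) = (\<lambda>t. a * linext n l m f x t + c * linext n l m f y t)"
    using xy F by (simp add: linext_eq sum_distrib_left sum.distrib algebra_simps)
qed

lemma linext_basis_vec:
  assumes "b \<in> basisW n l m"
  shows "linext n l m f (basis_vec b) = f b"
proof -
  have "linext n l m f (basis_vec b) = (\<lambda>t. \<Sum>b'\<in>{b}. basis_vec b b' * f b' t)"
    by (rule linext_eq[OF basis_vec_Wm[OF assms]]) (simp_all add: vsupp_basis_vec)
  then show ?thesis by (simp add: basis_vec_def)
qed

lemma linext_Wm: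
  assumes "\<And>b. b \<in> basisW n l m \<Longrightarrow> f b \<in> Wm n l m" "w \<in> Wm n l m"
  shows "linext n l m f w \<in> Wm n l m"
proof -
  have "linext n l m f w = (\<lambda>t. \<Sum>b\<in>vsupp w. w b * f b t)"
    using assms(2) by (intro linext_eq) (simp_all add: Wm_iff)
  also have "\<dots> \<in> Wm n l m"
    by (rule lincomb_closed_vsupp_sum[OF assms(2) lincomb_closed_Wm assms(1)])
  finally show ?thesis .
qed

lemma EndP_linextI:
  assumes Wm: "\<And>b. b \<in> basisW n l m \<Longrightarrow> f b \<in> Wm n l m"
    and commute: "\<And>i j k ys ls. p_gen n l i j k \<Longrightarrow> (ys, ls) \<in> basisW n l m \<Longrightarrow>
      (\<lambda>t. \<Sum>p<m. (if ys ! p = j then 1 else 0) * f (ys[p := i], ls[p := ls ! p + k]) t) = act m i j k (f (ys, ls))"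
  shows "linext n l m f \<in> EndP n l m"
proof -
  let ?T = "linext n l m f"
  have "?T (act m i j k w) = act m i j k (?T w)" if pg: "p_gen n l i j k" and w: "w \<in> Wm n l m" for i j k w
  proof (rule lin_on_eq_on_Wm[OF _ _ _ w])
    have i: "1 \<le> i" "i \<le> n * l" using pg by (simp_all add: p_gen_def)
    show "lin_on (Wm n l m) (\<lambda>w. ?T (act m i j k w))"
      using act_Wm[OF _ i] by (intro lin_on_comp[OF lin_on_act _ lin_on_linext])
    show "lin_on (Wm n l m) (\<lambda>w. act m i j k (?T w))"
      using linext_Wm[OF Wm] by (intro lin_on_comp[OF lin_on_linext _ lin_on_act])
    show "?T (act m i j k (basis_vec b)) = act m i j k (?T (basis_vec b))" if b: "b \<in> basisW n l m" for b
    proof -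
      obtain ys ls where yl: "b = (ys, ls)" "length ys = m" "length ls = m"
        using b by (cases b) (simp add: basisW_iff)
      have upd: "(ys[p := i], ls[p := ls ! p + k]) \<in> basisW n l m" for p
        using basisW_update[OF b[unfolded yl(1)] i] .
      have "?T (act m i j k (basis_vec b)) = (\<lambda>t. \<Sum>p<m. (if ys ! p = j then 1 else 0) * f (ys[p := i], ls[p := ls ! p + k]) t)"
        unfolding yl(1) act_basis_vec[OF yl(2,3)]
        using upd by (simp add: lin_on_sum[OF lincomb_closed_Wm lin_on_linext] basis_vec_Wm linext_basis_vec)
      also have "\<dots> = act m i j k (?T (basis_vec b))"
        using commute[OF pg b[unfolded yl(1)]] b yl(1) by (simp add: linext_basis_vec)
      finally show ?thesis .
    qed
  qed
  then show ?thesis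
    unfolding EndP_def using linext_Wm[OF Wm] lin_on_linext by (auto simp: linext_def)
qed

definition lift_hom :: "((idx \<Rightarrow> complex) \<Rightarrow> idx \<Rightarrow> complex) \<Rightarrow> nat \<Rightarrow> nat \<Rightarrow> nat \<Rightarrow> (idx \<Rightarrow> complex) \<Rightarrow> idx \<Rightarrow> complex" where
  "lift_hom S n l m =
     linext n l m (\<lambda>b. relabel (canon n l b) b (S (basis_vec (canon n l b, replicate m 0))))"

lemma lift_hom_EndP:
  assumes S: "S \<in> HomG n l m" and "0 < n" "m \<le> n" "0 < l"
  shows "lift_hom S n l m \<in> EndP n l m"
proof -
  define f where "f = (\<lambda>b. relabel (canon n l b) b (S (basis_vec (canon n l b, replicate m 0))))"
  have canon: "distinct (canon n l b)" "length (canon n l b) = m"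
    "S (basis_vec (canon n l b, replicate m 0)) \<in> Wm n l m" if "b \<in> basisW n l m" for b
    using canon_basisW[OF that assms(3,4)] HomG_Wm[OF S basis_vec_V0] by simp_all
  have "linext n l m f \<in> EndP n l m"
  proof (rule EndP_linextI)
    show "f b \<in> Wm n l m" if "b \<in> basisW n l m" for b
      using relabel_Wm[OF canon(1,2)[OF that] _ canon(3)[OF that]] that unfolding f_def by (cases b) simp
  next
    fix i j k ys ls assume pg: "p_gen n l i j k" and b: "(ys, ls) \<in> basisW n l m"
    define V where "V = canon n l (ys, ls)"
    define X where "X = S (basis_vec (V, replicate m 0))"
    have summand: "(if ys ! p = j then 1 else 0) * f (ys[p := i], ls[p := ls ! p + k]) t
      = (if ys ! p = j then 1 else 0) * relabel V (ys[p := i], ls[p := ls ! p + k]) X t" for p t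
      using canon_update[OF pg assms(2)] b unfolding f_def V_def X_def
      by (cases "ys ! p = j") (simp_all add: basisW_iff)
    have "(\<lambda>t. \<Sum>p<m. (if ys ! p = j then 1 else 0) * f (ys[p := i], ls[p := ls ! p + k]) t)
      = (\<lambda>t. \<Sum>p<m. (if ys ! p = j then 1 else 0) * relabel V (ys[p := i], ls[p := ls ! p + k]) X t)"
      by (simp only: summand)
    also have "\<dots> = act m i j k (f (ys, ls))"
      using relabel_act[OF canon(1,2)[OF b] _ _ canon(3)[OF b]] b unfolding f_def V_def X_def
      by (simp add: basisW_iff)
    finally show "(\<lambda>t. \<Sum>p<m. (if ys ! p = j then 1 else 0) * f (ys[p := i], ls[p := ls ! p + k]) t)
      = act m i j k (f (ys, ls))" .
  qed
  then show ?thesis unfolding lift_hom_def f_def .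
qed

lemma lift_hom_canon:
  assumes S: "S \<in> HomG n l m" and "m \<le> n" "0 < l" and ys: "(ys, replicate m 0) \<in> basisW n l m"
  defines "V \<equiv> canon n l (ys, replicate m 0)"
  shows "lift_hom S n l m (basis_vec (V, replicate m 0)) = S (basis_vec (V, replicate m 0))"
proof -
  note V = canon_basisW[OF ys assms(2,3), folded V_def]
  have "canon n l (V, replicate m 0) = V"
    using canon_canon[of "(ys, replicate m 0)" n l] assms(2,3) ys unfolding V_def by (simp add: basisW_iff)
  then have "lift_hom S n l m (basis_vec (V, replicate m 0)) =
      relabel V (V, replicate m 0) (S (basis_vec (V, replicate m 0)))"
    unfolding lift_hom_def using V(3) by (simp add: linext_basis_vec)
  also have "\<dots> = S (basis_vec (V, replicate m 0))"
    using HomG_support_mset[OF S V(3)] HomG_Wm[OF S basis_vec_V0[OF V(3)]]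
    by (intro relabel_self[OF V(1,2)]) (auto simp: vsupp_def)
  finally show ?thesis .
qed

lemma restrict_lift_hom:
  assumes S: "S \<in> HomG n l m" and "0 < n" "m \<le> n" "0 < l"
  shows "restrict (lift_hom S n l m) (V0 n l m) = S"
proof (rule HomG_eqI[OF restrict_EndP_HomG[OF lift_hom_EndP[OF assms]] S assms(2-4)])
  fix ys assume ys: "(ys, replicate m 0) \<in> basisW n l m"
  have "basis_vec (canon n l (ys, replicate m 0), replicate m 0) \<in> V0 n l m"
    using canon_basisW(3)[OF ys assms(3,4)] by (rule basis_vec_V0)
  then show "restrict (lift_hom S n l m) (V0 n l m) (basis_vec (canon n l (ys, replicate m 0), replicate m 0))
    = S (basis_vec (canon n l (ys, replicate m 0), replicate m 0))"
    using lift_hom_canon[OF S assms(3,4) ys] by simp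
qed

theorem lemma2p4:
  fixes n l m :: nat
  assumes "l > 1" and "n \<ge> m" and "m \<ge> 1"
  shows "bij_betw (\<lambda>T. restrict T (V0 n l m)) (EndP n l m) (HomG n l m)"
proof -
  have pos: "0 < n" "m \<le> n" "0 < l" using assms by simp_all
  have "S \<in> (\<lambda>T. restrict T (V0 n l m)) ` EndP n l m" if S: "S \<in> HomG n l m" for S
    by (rule rev_image_eqI[OF lift_hom_EndP[OF S pos]]) (simp add: restrict_lift_hom[OF S pos])
  then show ?thesis
    unfolding bij_betw_def using inj_on_restrict_EndP[OF pos] restrict_EndP_HomG
    by (intro conjI equalityI image_subsetI subsetI) auto
qed

end
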